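(* Let $\mathcal{X} \subset \mathbb{P}^n_{\mathbb{Z}}$ be an irreducible closed subscheme, let $l \in \Gamma(\mathbb{P}^n_{\mathbb{Z}}, \mathcal{O}(1))$ be a linear form, $\mathcal{H} := V(l) \subset \mathbb{P}^n_{\mathbb{Z}}$, and $\mathcal{U} := \mathcal{X} \setminus \mathcal{H}$. Denote the generic fibres of $\mathcal{X}$ and $\mathcal{U}$ by $X$ and $U$, respectively (so $X \subset \mathbb{P}^n_{\mathbb{Q}}$ and $U = X \setminus V(l)$). Assume that $U(\mathbb{R})$ is connected and that $U$ is weakly obstructed at the real place $\infty$. Then the set $\mathcal{U}(\mathbb{Z})$ of integral points is not Zariski-dense in $\mathcal{U}$.
   Context: Let $k$ be a number field, $\nu$ an archimedean place of $k$, $X \subset \mathbb{P}^n_k$ an irreducible closed subscheme, $l$ a linear form, $H = V(l)$, $U = X \setminus H$. One says $U$ is strongly unobstructed at $\nu$ if every connected component $U'$ of $U(k_\nu)$ satisfies: for every integer $d>0$, every finite collection of $k$-rational forms $s_1,\dots,s_r \in \Gamma(X,\mathcal{O}(d))$, none of which is a scalar multiple of $l^d$, and every constant $c \in \mathbb{R}$, there exists $x \in U'$ with $\|s_i(x)/l^d(x)\|_\nu \ge c$ for all $i \in \{1,\dots,r\}$. If $U$ is not strongly unobstructed at $\nu$, it is called weakly obstructed at $\nu$. Here $k=\mathbb{Q}$ and $\nu=\infty$ is the real place.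
   Formalization: The generic fibre X is additionally assumed reduced; otherwise the claim fails, e.g. for V(y², yz) in P² over Z with l = z, where the section y vanishes on all of U(R), so U = A¹ is weakly obstructed although its integral points are Zariski-dense. *)

theory Defs
  imports "HOL-Analysis.Analysis" "HOL-Library.Poly_Mapping"
begin

section \<open>Polynomials in the homogeneous coordinates\<close>

text \<open>
  Projective space $P^n$ has its homogeneous coordinates indexed by a finite type \<open>'n\<close> with
  $n + 1$ elements.  Polynomials are finitely supported maps from exponent vectors to
  coefficients; their product is the convolution product.
\<close>

type_synonym ('n, 'a) mpoly = "('n \<Rightarrow>\<^sub>0 nat) \<Rightarrow>\<^sub>0 'a"

definition var :: "'n \<Rightarrow> ('n, 'a::zero_neq_one) mpoly" where
  "var i = Poly_Mapping.single (Poly_Mapping.single i 1) 1"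

definition const :: "'a::zero \<Rightarrow> ('n, 'a) mpoly" where
  "const a = Poly_Mapping.single 0 a"

text \<open>Evaluation at \<open>x\<close> after applying \<open>h\<close> to the coefficients.\<close>

definition eval_poly ::
    "('a::zero \<Rightarrow> 'b::comm_semiring_1) \<Rightarrow> ('b ^ 'n::finite) \<Rightarrow> ('n, 'a) mpoly \<Rightarrow> 'b" where
  "eval_poly h x p =
     (\<Sum>m\<in>Poly_Mapping.keys p. h (Poly_Mapping.lookup p m) *
        (\<Prod>i\<in>UNIV. (x $ i) ^ Poly_Mapping.lookup m i))"

text \<open>The zero polynomial is homogeneous of every degree.\<close>

definition homogeneous :: "nat \<Rightarrow> ('n::finite, 'a::zero) mpoly \<Rightarrow> bool" where
  "homogeneous d p \<longleftrightarrow>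
     (\<forall>m\<in>Poly_Mapping.keys p. (\<Sum>i\<in>UNIV. Poly_Mapping.lookup m i) = d)"


section \<open>Ideals\<close>

text \<open>Ideals of a commutative ring are its submodules as a module over itself.\<close>

lemma module_times: "module ((*) :: 'a::comm_ring_1 \<Rightarrow> 'a \<Rightarrow> 'a)"
  by unfold_locales (simp_all add: algebra_simps)

abbreviation ring_ideal :: "'a::comm_ring_1 set \<Rightarrow> bool" where
  "ring_ideal \<equiv> module.subspace (*)"

abbreviation ideal_span :: "'a::comm_ring_1 set \<Rightarrow> 'a set" where
  "ideal_span \<equiv> module.span (*)"

definition ring_prime_ideal :: "'a::comm_ring_1 set \<Rightarrow> bool" where
  "ring_prime_ideal P \<longleftrightarrow>
     ring_ideal P \<and> 1 \<notin> P \<and> (\<forall>a b. a * b \<in> P \<longrightarrow> a \<in> P \<or> b \<in> P)"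

definition homogeneous_ideal :: "('n::finite, 'a::comm_ring_1) mpoly set \<Rightarrow> bool" where
  "homogeneous_ideal I \<longleftrightarrow> ring_ideal I \<and> I = ideal_span {f \<in> I. \<exists>d. homogeneous d f}"


section \<open>Projective space over a ring and its closed subschemes\<close>

definition proj_points :: "('n::finite, 'a::comm_ring_1) mpoly set set" where
  "proj_points = {P. homogeneous_ideal P \<and> ring_prime_ideal P \<and> (\<exists>i. var i \<notin> P)}"

definition zariski_topology :: "('n::finite, 'a::comm_ring_1) mpoly set topology" where
  "zariski_topology =
     topology_generated_by {{P \<in> proj_points. f \<notin> P} | f. \<exists>d. homogeneous d f}"

text \<open>
  A homogeneous ideal \<open>I\<close> presents the closed subscheme $\mathrm{Proj}(A[x]/I)$ of projective
  space over \<open>A\<close>, and every closed subscheme arises in this way.  Different ideals may present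
  the same subscheme; everything below is unaffected by this choice, since statements about the
  structure sheaf are made in the localisations at the coordinates.
\<close>

definition subscheme_points ::
    "('n::finite, 'a::comm_ring_1) mpoly set \<Rightarrow> ('n, 'a) mpoly set set" where
  "subscheme_points I = {P \<in> proj_points. I \<subseteq> P}"

definition complement_points ::
    "('n::finite, 'a::comm_ring_1) mpoly set \<Rightarrow> ('n, 'a) mpoly \<Rightarrow> ('n, 'a) mpoly set set" where
  "complement_points I l = {P \<in> subscheme_points I. l \<notin> P}"

definition irreducible_space :: "'a topology \<Rightarrow> bool" where
  "irreducible_space X \<longleftrightarrow> topspace X \<noteq> {} \<and>
     (\<forall>C D. closedin X C \<and> closedin X D \<and> C \<union> D = topspace X
        \<longrightarrow> C = topspace X \<or> D = topspace X)"

definition irreducible_subscheme :: "('n::finite, 'a::comm_ring_1) mpoly set \<Rightarrow> bool" where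
  "irreducible_subscheme I \<longleftrightarrow>
     irreducible_space (subtopology zariski_topology (subscheme_points I))"

text \<open>
  The ideal of the closed subscheme in the chart where \<open>x\<^sub>j\<close> is invertible: for \<open>f\<close>
  homogeneous of degree \<open>e\<close>, the fraction $f / x_j^e$ vanishes on the subscheme there iff
  \<open>f \<in> local_ideal I j\<close>.
\<close>

definition local_ideal ::
    "('n::finite, 'a::comm_ring_1) mpoly set \<Rightarrow> 'n \<Rightarrow> ('n, 'a) mpoly set" where
  "local_ideal I j = {f. \<exists>N. var j ^ N * f \<in> I}"

text \<open>Reducedness: no chart has a nonzero nilpotent function $f / x_j^e$.\<close>

definition reduced_subscheme :: "('n::finite, 'a::comm_ring_1) mpoly set \<Rightarrow> bool" where
  "reduced_subscheme I \<longleftrightarrow>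
     (\<forall>j e f m. homogeneous e f \<and> f ^ m \<in> local_ideal I j \<longrightarrow> f \<in> local_ideal I j)"

definition base_change :: "('n, int) mpoly \<Rightarrow> ('n, rat) mpoly" where
  "base_change = Poly_Mapping.map of_int"

definition generic_fibre :: "('n::finite, int) mpoly set \<Rightarrow> ('n, rat) mpoly set" where
  "generic_fibre I = ideal_span (base_change ` I)"


section \<open>Global sections of the twisting sheaves\<close>

text \<open>
  A global section of $O(d)$ on the closed subscheme given by \<open>I\<close> is a family of elements of
  degree \<open>d\<close> in the localisations of $k[x]/I$ at the coordinates $x_j$, the restrictions of
  which to the overlaps (the localisations at $x_i x_j$) agree.  The pair
  \<open>s j = (f, e)\<close> presents the local section $f / x_j^e$.  Presentations are not
  identified here; \<open>same_section\<close> is equality of the sections presented.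
\<close>

type_synonym 'n section_data = "'n \<Rightarrow> ('n, rat) mpoly \<times> nat"

definition is_global_section ::
    "('n::finite, rat) mpoly set \<Rightarrow> nat \<Rightarrow> 'n section_data \<Rightarrow> bool" where
  "is_global_section I d s \<longleftrightarrow>
     (\<forall>j. homogeneous (d + snd (s j)) (fst (s j))) \<and>
     (\<forall>i j. \<exists>N. (var i * var j) ^ N *
        (fst (s i) * var j ^ snd (s j) - fst (s j) * var i ^ snd (s i)) \<in> I)"

definition same_section ::
    "('n::finite, rat) mpoly set \<Rightarrow> 'n section_data \<Rightarrow> 'n section_data \<Rightarrow> bool" where
  "same_section I s t \<longleftrightarrow>
     (\<forall>j. fst (s j) * var j ^ snd (t j) - fst (t j) * var j ^ snd (s j) \<in> local_ideal I j)"

definition form_section :: "('n, rat) mpoly \<Rightarrow> 'n section_data" where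
  "form_section f = (\<lambda>j. (f, 0))"

definition scalar_multiple_of_form ::
    "('n::finite, rat) mpoly set \<Rightarrow> 'n section_data \<Rightarrow> ('n, rat) mpoly \<Rightarrow> bool" where
  "scalar_multiple_of_form I s g \<longleftrightarrow> (\<exists>a. same_section I s (form_section (const a * g)))"


section \<open>Real points\<close>

text \<open>Points of the real projective space are the lines through the origin.\<close>

definition real_proj_points :: "(real ^ 'n::finite) set set" where
  "real_proj_points = (\<lambda>x. span {x}) ` (- {0})"

definition real_proj_topology :: "(real ^ 'n::finite) set topology" where
  "real_proj_topology =
     topology (\<lambda>W. W \<subseteq> real_proj_points \<and> open {x. x \<noteq> 0 \<and> span {x} \<in> W})"

lemma openin_real_proj_topology:
  "openin real_proj_topology (W :: (real ^ 'n::finite) set set) \<longleftrightarrow>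
     W \<subseteq> real_proj_points \<and> open {x. x \<noteq> 0 \<and> span {x} \<in> W}"
proof -
  have "istopology (\<lambda>W :: (real ^ 'n) set set.
          W \<subseteq> real_proj_points \<and> open {x. x \<noteq> 0 \<and> span {x} \<in> W})"
    unfolding istopology_def
  proof (intro conjI allI impI)
    fix S T :: "(real ^ 'n) set set"
    assume S: "S \<subseteq> real_proj_points \<and> open {x. x \<noteq> 0 \<and> span {x} \<in> S}"
      and T: "T \<subseteq> real_proj_points \<and> open {x. x \<noteq> 0 \<and> span {x} \<in> T}"
    have eq: "{x. x \<noteq> 0 \<and> span {x} \<in> S \<inter> T} =
        {x. x \<noteq> 0 \<and> span {x} \<in> S} \<inter> {x. x \<noteq> 0 \<and> span {x} \<in> T}" by auto
    show "S \<inter> T \<subseteq> real_proj_points" using S by blast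
    show "open {x. x \<noteq> 0 \<and> span {x} \<in> S \<inter> T}" unfolding eq using S T by blast
  next
    fix K :: "(real ^ 'n) set set set"
    assume K: "\<forall>W\<in>K. W \<subseteq> real_proj_points \<and> open {x. x \<noteq> 0 \<and> span {x} \<in> W}"
    have eq: "{x. x \<noteq> 0 \<and> span {x} \<in> \<Union>K} = (\<Union>W\<in>K. {x. x \<noteq> 0 \<and> span {x} \<in> W})" by auto
    show "\<Union>K \<subseteq> real_proj_points" using K by blast
    show "open {x. x \<noteq> 0 \<and> span {x} \<in> \<Union>K}" unfolding eq using K by blast
  qed
  then show ?thesis
    unfolding real_proj_topology_def by (simp add: topology_inverse')
qed

lemma quotient_map_real_proj:
  "quotient_map (top_of_set (- {0})) real_proj_topology (\<lambda>x :: real ^ 'n::finite. span {x})"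
proof -
  have "{x. x \<noteq> 0 \<and> span {x} \<in> real_proj_points} = - {0 :: real ^ 'n}"
    by (auto simp: real_proj_points_def)
  then have "openin real_proj_topology (real_proj_points :: (real ^ 'n) set set)"
    by (simp add: openin_real_proj_topology open_Compl)
  then have "topspace real_proj_topology = (real_proj_points :: (real ^ 'n) set set)"
    by (meson openin_real_proj_topology openin_subset openin_topspace subset_antisym)
  then show ?thesis
    unfolding quotient_map_def
    by (auto simp: openin_real_proj_topology openin_open_eq open_Compl real_proj_points_def)
qed

definition real_points ::
    "('n::finite, rat) mpoly set \<Rightarrow> ('n, rat) mpoly \<Rightarrow> (real ^ 'n) set set" where
  "real_points I l =
     {span {x} | x. x \<noteq> 0 \<and> (\<forall>f\<in>I. eval_poly of_rat x f = 0) \<and> eval_poly of_rat x l \<noteq> 0}"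

definition real_points_topology ::
    "('n::finite, rat) mpoly set \<Rightarrow> ('n, rat) mpoly \<Rightarrow> (real ^ 'n) set topology" where
  "real_points_topology I l = subtopology real_proj_topology (real_points I l)"

text \<open>
  The value of a section on the coordinate vector \<open>x\<close>, computed in any chart containing the
  point.  It scales with \<open>x\<close> like a form of degree \<open>d\<close>, so that
  \<open>section_quotient\<close> only depends on the line through \<open>x\<close>.
\<close>

definition section_value :: "'n::finite section_data \<Rightarrow> real ^ 'n \<Rightarrow> real" where
  "section_value s x =
     (let j = (SOME j. x $ j \<noteq> 0) in eval_poly of_rat x (fst (s j)) / (x $ j) ^ snd (s j))"

definition section_quotient ::
    "'n::finite section_data \<Rightarrow> ('n, rat) mpoly \<Rightarrow> nat \<Rightarrow> real ^ 'n \<Rightarrow> real" where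
  "section_quotient s l d x = section_value s x / (eval_poly of_rat x l) ^ d"


section \<open>Obstruction at the real place\<close>

definition strongly_unobstructed ::
    "('n::finite, rat) mpoly set \<Rightarrow> ('n, rat) mpoly \<Rightarrow> bool" where
  "strongly_unobstructed I l \<longleftrightarrow>
     (\<forall>U'\<in>connected_components_of (real_points_topology I l).
        \<forall>d>0. \<forall>S. finite S \<and>
            (\<forall>s\<in>S. is_global_section I d s \<and> \<not> scalar_multiple_of_form I s (l ^ d)) \<longrightarrow>
          (\<forall>c. \<exists>x. x \<noteq> 0 \<and> span {x} \<in> U' \<and> (\<forall>s\<in>S. \<bar>section_quotient s l d x\<bar> \<ge> c)))"

definition weakly_obstructed ::
    "('n::finite, rat) mpoly set \<Rightarrow> ('n, rat) mpoly \<Rightarrow> bool" where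
  "weakly_obstructed I l \<longleftrightarrow> \<not> strongly_unobstructed I l"


section \<open>Integral points\<close>

text \<open>
  Since every line bundle on $\mathrm{Spec}\,\mathbb{Z}$ is trivial, the sections of projective
  space over it are the primitive integer vectors up to sign.  Such a section factors through the
  complement of $V(l)$ iff \<open>l\<close> vanishes at \<open>x\<close> modulo no prime, that is, takes a unit as
  its value.  Both signs of a vector are kept; they have the same image.
\<close>

definition integral_points ::
    "('n::finite, int) mpoly set \<Rightarrow> ('n, int) mpoly \<Rightarrow> (int ^ 'n) set" where
  "integral_points I l =
     {x. Gcd (range (($) x)) = 1 \<and> (\<forall>f\<in>I. eval_poly id x f = 0) \<and> is_unit (eval_poly id x l)}"

text \<open>
  The image in projective space of the section of $\mathrm{Spec}\,\mathbb{Z}$ given by \<open>x\<close>: a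
  prime ideal \<open>Q\<close> of the integers goes to the ideal generated by the forms whose value at
  \<open>x\<close> is in \<open>Q\<close>.
\<close>

definition section_image :: "int ^ 'n::finite \<Rightarrow> ('n, int) mpoly set set" where
  "section_image x =
     {ideal_span {f. (\<exists>d. homogeneous d f) \<and> eval_poly id x f \<in> Q} | Q. ring_prime_ideal Q}"

definition integral_points_zariski_dense ::
    "('n::finite, int) mpoly set \<Rightarrow> ('n, int) mpoly \<Rightarrow> bool" where
  "integral_points_zariski_dense I l \<longleftrightarrow>
     subtopology zariski_topology (complement_points I l)
       closure_of (\<Union>x\<in>integral_points I l. section_image x) = complement_points I l"

end

theory Submission
  imports Defs "HOL-Computational_Algebra.Polynomial"
begin

text \<open>
  Connectedness makes the obstruction global: finitely many sections \<open>s\<close> of $O(d)$, none a multiple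
  of $l^d$, such that at every real point of $U$ some quotient $s / l^d$ is bounded by \<open>c\<close>.  At an
  integral point \<open>l\<close> takes the value $\pm 1$, and the value of \<open>s\<close> there is rational with a
  denominator depending only on \<open>s\<close>; hence $s / l^d$ takes one of finitely many values \<open>a\<close>.  Every
  integral point is therefore a zero of one of finitely many sections $s - a l^d$, all nonzero on
  the generic fibre.  Multiplied by a coordinate, the numerator of such a section in a suitable
  chart is a form over the integers that vanishes wherever the section does but, by reducedness,
  is not nilpotent on the scheme.  By irreducibility the product of these forms and \<open>l\<close> is nonzero
  at some point, so the zero locus of the product of the forms is a proper closed subset of the
  complement that contains all integral points.
\<close>

section \<open>Homomorphisms on polynomial rings\<close>

text \<open>Updating at a fresh key amounts to adding a single term. Additive properties thus reduce
  to monomials, with no bookkeeping of supports.\<close>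

lemma poly_mapping_single_plus_induct [case_names zero single plus]:
  assumes "P 0" "\<And>m a. P (Poly_Mapping.single m a)" "\<And>p q. P p \<Longrightarrow> P q \<Longrightarrow> P (p + q)"
  shows "P (p :: 'k \<Rightarrow>\<^sub>0 'a::comm_monoid_add)"
proof (induction p rule: update_induct)
  case const
  show ?case by fact
next
  case (update f a b)
  then have "Poly_Mapping.lookup f a = 0"
    by (simp add: in_keys_iff)
  then have "Poly_Mapping.update a b f = f + Poly_Mapping.single a b"
    by (intro poly_mapping_eqI) (auto simp: lookup_update lookup_add lookup_single when_def)
  with update assms show ?case
    by metis
qed

text \<open>For a ring homomorphism \<open>h\<close> and a monoid homomorphism \<open>\<mu>\<close>
  this is the map given by the universal property of a monoid algebra. Evaluation, base change and
  the grading are instances and share one proof of being ring homomorphisms.\<close>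

definition extend_hom ::
    "('a::zero \<Rightarrow> 'b::comm_semiring_1) \<Rightarrow> ('k \<Rightarrow> 'b) \<Rightarrow> ('k \<Rightarrow>\<^sub>0 'a) \<Rightarrow> 'b" where
  "extend_hom h \<mu> p = (\<Sum>m\<in>Poly_Mapping.keys p. h (Poly_Mapping.lookup p m) * \<mu> m)"

lemma extend_hom_0 [simp]: "extend_hom h \<mu> 0 = 0"
  by (simp add: extend_hom_def)

lemma extend_hom_single: "h 0 = 0 \<Longrightarrow> extend_hom h \<mu> (Poly_Mapping.single m a) = h a * \<mu> m"
  by (simp add: extend_hom_def)

lemma extend_hom_add:
  assumes "h 0 = 0" "\<And>a b. h (a + b) = h a + h b"
  shows "extend_hom h \<mu> (p + q) = extend_hom h \<mu> p + extend_hom h \<mu> q"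
  unfolding extend_hom_def using assms
  by (intro setsum_keys_plus_distrib) (simp_all add: algebra_simps)

text \<open>Both sides are additive in \<open>p\<close> and in \<open>q\<close>, so two nested
  inductions leave only products of monomials, where \<open>h\<close> and \<open>\<mu>\<close> are
  multiplicative.\<close>

lemma extend_hom_mult:
  fixes h :: "'a::comm_semiring_1 \<Rightarrow> 'b::comm_semiring_1"
  assumes "h 0 = 0" "\<And>a b. h (a + b) = h a + h b" "\<And>a b. h (a * b) = h a * h b"
    and "\<And>m n. \<mu> (m + n) = \<mu> m * \<mu> (n :: 'k::comm_monoid_add)"
  shows "extend_hom h \<mu> (p * q) = extend_hom h \<mu> p * extend_hom h \<mu> q"
proof (induction p rule: poly_mapping_single_plus_induct)
  case (single m a)
  show ?case
  proof (induction q rule: poly_mapping_single_plus_induct)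
    case (single n b)
    show ?case
      using assms by (simp add: extend_hom_single mult_single algebra_simps)
  qed (use assms in \<open>simp_all add: extend_hom_add algebra_simps\<close>)
qed (use assms in \<open>simp_all add: extend_hom_add algebra_simps\<close>)

lemma eval_poly_conv_extend_hom:
  "eval_poly h x = extend_hom h (\<lambda>m. \<Prod>i\<in>UNIV. (x $ i) ^ Poly_Mapping.lookup m i)"
  by (simp add: eval_poly_def extend_hom_def fun_eq_iff)

locale ring_hom_1 =
  fixes h :: "'a::comm_ring_1 \<Rightarrow> 'b::comm_ring_1"
  assumes hom_add: "h (a + b) = h a + h b"
    and hom_mult: "h (a * b) = h a * h b"
    and hom_1: "h 1 = 1"
begin

lemma hom_0: "h 0 = 0"
  using hom_add[of 0 0] by simp

lemma hom_minus: "h (- a) = - h a"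
  using hom_add[of a "- a"] hom_0 by (simp add: eq_neg_iff_add_eq_0 add.commute)

lemma hom_diff: "h (a - b) = h a - h b"
  using hom_add[of a "- b"] hom_minus by simp

lemma hom_power: "h (a ^ n) = h a ^ n"
  by (induction n) (simp_all add: hom_mult hom_1)

lemma hom_prod: "h (prod f A) = (\<Prod>x\<in>A. h (f x))"
  by (induction A rule: infinite_finite_induct) (simp_all add: hom_mult hom_1)

lemma extend_hom_ring_hom:
  assumes "\<mu> 0 = 1" "\<And>m n. \<mu> (m + n) = \<mu> m * \<mu> (n :: 'k::comm_monoid_add)"
  shows "ring_hom_1 (extend_hom h \<mu>)"
proof
  show "extend_hom h \<mu> 1 = 1"
    unfolding single_one[symmetric] using assms by (simp add: extend_hom_single hom_0 hom_1 del: single_one)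
qed (use assms in \<open>simp_all add: extend_hom_add extend_hom_mult hom_0 hom_add hom_mult\<close>)

lemma eval_poly_ring_hom: "ring_hom_1 (eval_poly h (x :: 'b ^ 'n::finite))"
  unfolding eval_poly_conv_extend_hom
  by (rule extend_hom_ring_hom) (simp_all add: lookup_add power_add prod.distrib)

lemma eval_poly_var: "eval_poly h (x :: 'b ^ 'n::finite) (var i) = x $ i"
proof -
  have "(x $ j) ^ Poly_Mapping.lookup (Poly_Mapping.single i 1) j = (if j = i then x $ j else 1)" for j
    by (simp add: lookup_single)
  then show ?thesis
    by (simp add: var_def eval_poly_conv_extend_hom extend_hom_single hom_0 hom_1)
qed

lemma eval_poly_const: "eval_poly h (x :: 'b ^ 'n::finite) (const a) = h a"
  by (simp add: const_def eval_poly_conv_extend_hom extend_hom_single hom_0)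

end

interpretation int_to_int: ring_hom_1 "id :: int \<Rightarrow> int"
  by unfold_locales simp_all

interpretation rat_to_real: ring_hom_1 "of_rat :: rat \<Rightarrow> real"
  by unfold_locales (simp_all add: of_rat_add of_rat_mult)

interpretation int_eval: ring_hom_1 "eval_poly id (x :: int ^ 'n::finite)" for x
  by (rule int_to_int.eval_poly_ring_hom)

interpretation real_eval: ring_hom_1 "eval_poly of_rat (x :: real ^ 'n::finite)" for x
  by (rule rat_to_real.eval_poly_ring_hom)

section \<open>Base change from integer to rational coefficients\<close>

lemma lookup_base_change: "Poly_Mapping.lookup (base_change f) m = of_int (Poly_Mapping.lookup f m)"
  by (simp add: base_change_def Poly_Mapping.map.rep_eq when_def)

lemma keys_base_change: "Poly_Mapping.keys (base_change f) = Poly_Mapping.keys f"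
  by (auto simp: in_keys_iff lookup_base_change)

lemma base_change_single:
  "base_change (Poly_Mapping.single m a) = Poly_Mapping.single m (of_int a)"
  by (auto intro!: poly_mapping_eqI simp: lookup_base_change lookup_single when_def)

lemma base_change_conv_extend_hom:
  "base_change = extend_hom (\<lambda>a. const (of_int a)) (\<lambda>m. Poly_Mapping.single m 1)"
proof
  fix f :: "('n, int) mpoly"
  show "base_change f = extend_hom (\<lambda>a. const (of_int a)) (\<lambda>m. Poly_Mapping.single m 1) f"
  proof (induction f rule: poly_mapping_single_plus_induct)
    case (plus p q)
    have "base_change (p + q) = base_change p + base_change q"
      by (rule poly_mapping_eqI) (simp add: lookup_base_change lookup_add)
    with plus show ?case
      by (simp add: extend_hom_add const_def single_add)
  next
    case zero
    show ?case
      by (rule poly_mapping_eqI) (simp add: lookup_base_change)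
  qed (simp add: base_change_single extend_hom_single const_def mult_single del: single_of_int)
qed

interpretation int_const: ring_hom_1 "\<lambda>a :: int. const (of_int a) :: ('n, rat) mpoly"
  by unfold_locales (simp_all add: const_def single_add mult_single del: single_of_int)

interpretation base_change: ring_hom_1 "base_change :: ('n, int) mpoly \<Rightarrow> ('n, rat) mpoly"
  unfolding base_change_conv_extend_hom
  by (rule int_const.extend_hom_ring_hom) (simp_all add: mult_single)

lemma base_change_var: "base_change (var i) = var i"
  by (simp add: var_def base_change_single)

lemma homogeneous_base_change: "homogeneous d (base_change f) \<longleftrightarrow> homogeneous d f"
  by (simp add: homogeneous_def keys_base_change)

lemma eval_poly_base_change:
  fixes x :: "int ^ 'n::finite"
  shows "eval_poly of_rat (\<chi> i. of_int (x $ i)) (base_change f) = (of_int (eval_poly id x f) :: real)"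
  by (simp add: eval_poly_def keys_base_change lookup_base_change of_rat_of_int_eq)

section \<open>Degrees of forms and homogeneous components\<close>

lemma homogeneous_mult:
  fixes p q :: "('n::finite, 'a::comm_ring_1) mpoly"
  assumes "homogeneous d p" "homogeneous e q"
  shows "homogeneous (d + e) (p * q)"
  unfolding homogeneous_def
proof
  fix m assume "m \<in> Poly_Mapping.keys (p * q)"
  then obtain a b where "m = a + b" "a \<in> Poly_Mapping.keys p" "b \<in> Poly_Mapping.keys q"
    using keys_mult[of p q] by blast
  with assms show "(\<Sum>i\<in>UNIV. Poly_Mapping.lookup m i) = d + e"
    by (auto simp: homogeneous_def lookup_add sum.distrib)
qed

lemma homogeneous_diff:
  fixes p q :: "('n::finite, 'a::comm_ring_1) mpoly"
  assumes "homogeneous d p" "homogeneous d q"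
  shows "homogeneous d (p - q)"
  using assms by (auto simp: homogeneous_def in_keys_iff lookup_minus) 

lemma homogeneous_1: "homogeneous 0 (1 :: ('n::finite, 'a::comm_ring_1) mpoly)"
  by (simp add: homogeneous_def)

lemma homogeneous_const: "homogeneous 0 (const a :: ('n::finite, 'a::comm_ring_1) mpoly)"
  by (simp add: homogeneous_def const_def)

lemma homogeneous_var: "homogeneous 1 (var i :: ('n::finite, 'a::comm_ring_1) mpoly)"
  by (simp add: homogeneous_def var_def lookup_single when_def)

lemma homogeneous_power:
  fixes p :: "('n::finite, 'a::comm_ring_1) mpoly"
  shows "homogeneous d p \<Longrightarrow> homogeneous (d * k) (p ^ k)"
  using homogeneous_mult by (induction k) (force simp: homogeneous_1)+

lemma homogeneous_prod:
  fixes f :: "'s \<Rightarrow> ('n::finite, 'a::comm_ring_1) mpoly"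
  shows "(\<And>s. s \<in> S \<Longrightarrow> homogeneous (d s) (f s)) \<Longrightarrow> homogeneous (sum d S) (prod f S)"
  by (induction S rule: infinite_finite_induct) (simp_all add: homogeneous_1 homogeneous_mult)

text \<open>
  The homogeneous components of a polynomial, as coefficients of powers of an additional variable.
\<close>

definition grading :: "('n::finite, 'a::comm_ring_1) mpoly \<Rightarrow> ('n, 'a) mpoly poly" where
  "grading = extend_hom (\<lambda>a. [:const a:])
     (\<lambda>m. monom (Poly_Mapping.single m 1) (\<Sum>i\<in>UNIV. Poly_Mapping.lookup m i))"

interpretation const_poly: ring_hom_1 "\<lambda>a :: 'a::comm_ring_1. [:const a :: ('n, 'a) mpoly:]"
  by unfold_locales (simp_all add: const_def single_add mult_single one_pCons mult.commute)

interpretation grading: ring_hom_1 "grading :: ('n::finite, 'a::comm_ring_1) mpoly \<Rightarrow> _"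
  unfolding grading_def
  by (rule const_poly.extend_hom_ring_hom)
    (simp_all add: mult_single mult_monom lookup_add sum.distrib monom_0 one_pCons)

lemma grading_single:
  "grading (Poly_Mapping.single m a) =
     monom (Poly_Mapping.single m a) (\<Sum>i\<in>UNIV. Poly_Mapping.lookup m i)"
  by (simp add: grading_def extend_hom_single const_def smult_monom mult_single)

lemma poly_grading_1: "poly (grading f) 1 = f"
  by (induction f rule: poly_mapping_single_plus_induct)
    (simp_all add: grading_single poly_monom grading.hom_0 grading.hom_add)

lemma homogeneous_coeff_grading: "homogeneous d (coeff (grading f) d)"
proof (induction f rule: poly_mapping_single_plus_induct)
  case (plus p q)
  then show ?case
    by (auto simp: grading.hom_add homogeneous_def in_keys_iff lookup_add)
qed (auto simp: grading.hom_0 homogeneous_def grading_single)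

lemma lookup_coeff_grading:
  "Poly_Mapping.lookup (coeff (grading f) d) m =
     (if (\<Sum>i\<in>UNIV. Poly_Mapping.lookup m i) = d then Poly_Mapping.lookup f m else 0)"
  by (induction f rule: poly_mapping_single_plus_induct)
    (auto simp: grading.hom_0 grading.hom_add lookup_add grading_single lookup_single when_def)

lemma coeff_grading_homogeneous:
  "homogeneous d f \<Longrightarrow> coeff (grading f) e = (if e = d then f else 0)"
  by (rule poly_mapping_eqI) (auto simp: lookup_coeff_grading homogeneous_def in_keys_iff)

section \<open>Existence of homogeneous prime ideals\<close>

interpretation ideal: module "(*) :: 'a::comm_ring_1 \<Rightarrow> 'a \<Rightarrow> 'a"
  by (rule module_times)

text \<open>Here \<open>scale_scale\<close> is associativity read from right to left, which loops against \<open>ac_simps\<close>.\<close>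
declare ideal.scale_scale [simp del]

lemma (in ring_hom_1) subspace_kernel: "ring_ideal {f. h f = 0}"
  by (rule ideal.subspaceI) (simp_all add: hom_0 hom_add hom_mult)

text \<open>By Zorn's lemma some ideal is maximal among those that contain \<open>I\<close> and no
  power of \<open>g\<close>; maximality forces it to be prime. The power with exponent 0 makes it
  proper.\<close>

lemma ring_ideal_avoiding_powers_imp_prime:
  fixes I :: "'a::comm_ring_1 set"
  assumes "ring_ideal I" "\<And>m. g ^ m \<notin> I"
  obtains P where "ring_prime_ideal P" "I \<subseteq> P" "\<And>m. g ^ m \<notin> P"
proof -
  define \<A> where "\<A> = {J. ring_ideal J \<and> I \<subseteq> J \<and> (\<forall>m. g ^ m \<notin> J)}"
  have "\<exists>M\<in>\<A>. \<forall>X\<in>\<A>. M \<subseteq> X \<longrightarrow> X = M"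
  proof (rule subset_Zorn_nonempty)
    show "\<A> \<noteq> {}"
      using assms by (auto simp: \<A>_def)
    fix \<C> assume "\<C> \<noteq> {}" and chain: "subset.chain \<A> \<C>"
    have sub: "J \<in> \<C> \<Longrightarrow> ring_ideal J" for J
      using chain by (auto simp: subset.chain_def \<A>_def)
    have "ring_ideal (\<Union>\<C>)"
    proof (rule ideal.subspaceI)
      show "0 \<in> \<Union>\<C>"
        using \<open>\<C> \<noteq> {}\<close> sub ideal.subspace_0 by blast
    next
      fix x y assume "x \<in> \<Union>\<C>" "y \<in> \<Union>\<C>"
      then obtain J K where JK: "J \<in> \<C>" "x \<in> J" "K \<in> \<C>" "y \<in> K"
        by blast
      then have "J \<subseteq> K \<or> K \<subseteq> J"
        using chain by (auto simp: subset.chain_def)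
      with JK show "x + y \<in> \<Union>\<C>"
        by (meson UnionI ideal.subspace_add sub subsetD)
    next
      show "c * x \<in> \<Union>\<C>" if "x \<in> \<Union>\<C>" for c x
        using that sub ideal.subspace_scale by blast
    qed
    with \<open>\<C> \<noteq> {}\<close> chain show "\<Union>\<C> \<in> \<A>"
      by (auto simp: subset.chain_def \<A>_def)
  qed
  then obtain M where "M \<in> \<A>" and max: "\<And>X. X \<in> \<A> \<Longrightarrow> M \<subseteq> X \<Longrightarrow> X = M"
    by blast
  then have M: "ring_ideal M" "I \<subseteq> M" "\<And>m. g ^ m \<notin> M"
    by (auto simp: \<A>_def)
  \<comment> \<open>By maximality, adjoining \<open>a\<close> to \<open>M\<close> brings in a power
    of \<open>g\<close>, so some \<open>g ^ m\<close> is a multiple of \<open>a\<close> modulo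
    \<open>M\<close>.\<close>
  have power: "\<exists>m k. g ^ m - k * a \<in> M" if "a \<notin> M" for a
  proof (rule ccontr)
    assume none: "\<not> ?thesis"
    have "insert a M \<subseteq> ideal_span (insert a M)"
      by (rule ideal.span_superset)
    moreover have "ideal_span M = M"
      using M(1) by simp
    then have "g ^ m \<notin> ideal_span (insert a M)" for m
      using none ideal.span_breakdown_eq[of "g ^ m" a M] by blast
    ultimately have "ideal_span (insert a M) \<in> \<A>"
      using M(2) by (auto simp: \<A>_def)
    with max \<open>insert a M \<subseteq> _\<close> that show False
      by blast
  qed
  have "a \<in> M \<or> b \<in> M" if "a * b \<in> M" for a b
  proof (rule ccontr)
    assume "\<not> ?thesis"
    with power[of a] power[of b] obtain m k n j
      where "g ^ m - k * a \<in> M" "g ^ n - j * b \<in> M"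
      by blast
    \<comment> \<open>Multiplying the congruences of \<open>g ^ m\<close> with \<open>k * a\<close>
      and of \<open>g ^ n\<close> with \<open>j * b\<close> modulo \<open>M\<close> shows that
      \<open>g ^ (m + n)\<close> is congruent to a multiple of \<open>a * b\<close>, hence lies in
      \<open>M\<close>.\<close>
    then have "g ^ n * (g ^ m - k * a) + ((k * a) * (g ^ n - j * b) + (k * j) * (a * b)) \<in> M"
      using that ideal.subspace_scale[OF M(1)] by (intro ideal.subspace_add[OF M(1)])
    moreover have "g ^ n * (g ^ m - k * a) + ((k * a) * (g ^ n - j * b) + (k * j) * (a * b)) = g ^ (m + n)"
      by (simp add: algebra_simps power_add)
    ultimately have "g ^ (m + n) \<in> M"
      by simp
    with M(3) show False
      by blast
  qed
  moreover have "1 \<notin> M"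
    using M(3)[of 0] by simp
  ultimately show ?thesis
    using that[of M] M by (auto simp: ring_prime_ideal_def)
qed

text \<open>For an ideal \<open>P\<close> this is the largest homogeneous ideal contained in it.
  Passing to it turns an arbitrary prime, as Zorn's lemma supplies, into a candidate for a point of
  projective space.\<close>

definition homogeneous_core :: "('n::finite, 'a::comm_ring_1) mpoly set \<Rightarrow> ('n, 'a) mpoly set" where
  "homogeneous_core P = {f. \<forall>d. coeff (grading f) d \<in> P}"

lemma ring_ideal_homogeneous_core:
  assumes "ring_ideal P"
  shows "ring_ideal (homogeneous_core P)"
proof (rule ideal.subspaceI)
  show "c * x \<in> homogeneous_core P" if "x \<in> homogeneous_core P" for c x
    using that assms unfolding homogeneous_core_def
    by (auto simp: grading.hom_mult coeff_mult intro: ideal.subspace_sum ideal.subspace_scale)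
qed (use assms in \<open>auto simp: homogeneous_core_def grading.hom_0 grading.hom_add
        intro: ideal.subspace_0 ideal.subspace_add\<close>)

lemma homogeneous_in_core_iff:
  assumes "ring_ideal P" "homogeneous d f"
  shows "f \<in> homogeneous_core P \<longleftrightarrow> f \<in> P"
  using assms ideal.subspace_0[OF assms(1)]
  by (auto simp: homogeneous_core_def coeff_grading_homogeneous)

text \<open>An element of the core is the sum of its homogeneous components, and these lie in the
  core again.\<close>

lemma homogeneous_ideal_core:
  assumes "ring_ideal P"
  shows "homogeneous_ideal (homogeneous_core P)"
  unfolding homogeneous_ideal_def
proof (intro conjI subset_antisym)
  let ?S = "{f \<in> homogeneous_core P. \<exists>d. homogeneous d f}"
  show core: "ring_ideal (homogeneous_core P)"
    using assms by (rule ring_ideal_homogeneous_core)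
  show "ideal_span ?S \<subseteq> homogeneous_core P"
    using core by (intro ideal.span_minimal) auto
  show "homogeneous_core P \<subseteq> ideal_span ?S"
  proof
    fix f assume f: "f \<in> homogeneous_core P"
    have "coeff (grading f) d \<in> ?S" for d
      using f homogeneous_coeff_grading[of d f]
        homogeneous_in_core_iff[OF assms homogeneous_coeff_grading[of d f]]
      unfolding homogeneous_core_def by blast
    then have "(\<Sum>d\<le>degree (grading f). coeff (grading f) d) \<in> ideal_span ?S"
      by (intro ideal.span_sum ideal.span_base)
    then show "f \<in> ideal_span ?S"
      using poly_grading_1[of f] by (simp add: poly_altdef)
  qed
qed

text \<open>Supplies a leading term modulo \<open>P\<close>: the indices of coefficients outside
  \<open>P\<close> are bounded by the degree, since \<open>0\<close> lies in \<open>P\<close>, so a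
  greatest one exists.\<close>

lemma max_coeff_notin:
  fixes p :: "'a::comm_ring_1 poly"
  assumes "ring_ideal P" "coeff p i \<notin> P"
  obtains d where "coeff p d \<notin> P" "\<And>e. e > d \<Longrightarrow> coeff p e \<in> P"
proof -
  have "coeff p e \<notin> P \<Longrightarrow> e \<le> degree p" for e
    using ideal.subspace_0[OF assms(1)] coeff_eq_0[of p e] by force
  then have "coeff p (GREATEST e. coeff p e \<notin> P) \<notin> P"
    and "coeff p e \<notin> P \<Longrightarrow> e \<le> (GREATEST e. coeff p e \<notin> P)" for e
    using assms(2) GreatestI_nat[of "\<lambda>e. coeff p e \<notin> P" i "degree p"]
      Greatest_le_nat[of "\<lambda>e. coeff p e \<notin> P" e "degree p"] by blast+
  then show ?thesis
    using that by (meson leD)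
qed

text \<open>A leading-term argument. If neither \<open>a\<close> nor \<open>b\<close> lies in the
  core, let \<open>d\<close> and \<open>e\<close> be the degrees of their top components outside
  \<open>P\<close>. In degree \<open>d + e\<close> of the product every other term has a factor in
  \<open>P\<close>, so the product of these two components lies in \<open>P\<close>, against
  primality.\<close>

lemma ring_prime_ideal_homogeneous_core:
  assumes prime: "ring_prime_ideal P"
  shows "ring_prime_ideal (homogeneous_core P)"
proof -
  have P: "ring_ideal P"
    using prime by (simp add: ring_prime_ideal_def)
  have "a \<in> homogeneous_core P \<or> b \<in> homogeneous_core P" if "a * b \<in> homogeneous_core P" for a b
  proof (rule ccontr)
    assume "\<not> ?thesis"
    then obtain i j where "coeff (grading a) i \<notin> P" "coeff (grading b) j \<notin> P"
      by (auto simp: homogeneous_core_def)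
    then obtain d e
      where d: "coeff (grading a) d \<notin> P" "\<And>k. k > d \<Longrightarrow> coeff (grading a) k \<in> P"
        and e: "coeff (grading b) e \<notin> P" "\<And>k. k > e \<Longrightarrow> coeff (grading b) k \<in> P"
      using max_coeff_notin[OF P] by metis
    let ?t = "\<lambda>i. coeff (grading a) i * coeff (grading b) (d + e - i)"
    have "?t i \<in> P" if "i \<in> {..d + e} - {d}" for i
    proof (cases "i > d")
      case True
      then show ?thesis
        using d(2) ideal.subspace_scale[OF P, of "coeff (grading a) i" "coeff (grading b) (d + e - i)"]
        by (simp add: mult.commute)
    next
      case False
      with that have "d + e - i > e"
        by auto
      then show ?thesis
        using e(2) ideal.subspace_scale[OF P] by blast
    qed
    then have "sum ?t ({..d + e} - {d}) \<in> P"
      using P by (intro ideal.subspace_sum) auto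
    moreover have "coeff (grading (a * b)) (d + e) = ?t d + sum ?t ({..d + e} - {d})"
      unfolding grading.hom_mult coeff_mult by (rule sum.remove) auto
    moreover have "coeff (grading (a * b)) (d + e) \<in> P"
      using that by (simp add: homogeneous_core_def)
    ultimately have "?t d \<in> P"
      using ideal.subspace_diff[OF P, of "coeff (grading (a * b)) (d + e)" "sum ?t ({..d + e} - {d})"]
      by simp
    then have "coeff (grading a) d * coeff (grading b) e \<in> P"
      by simp
    with prime d(1) e(1) show False
      unfolding ring_prime_ideal_def by blast
  qed
  moreover have "1 \<notin> homogeneous_core P"
    using prime homogeneous_in_core_iff[OF P homogeneous_1] by (simp add: ring_prime_ideal_def)
  ultimately show ?thesis
    using ring_ideal_homogeneous_core[OF P] by (auto simp: ring_prime_ideal_def)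
qed

text \<open>The factor \<open>var j\<close> keeps the prime ideal away from the irrelevant ideal.\<close>

lemma proj_point_avoiding:
  fixes I :: "('n::finite, 'a::comm_ring_1) mpoly set"
  assumes I: "homogeneous_ideal I" and g: "homogeneous d g" "\<And>m. (var j * g) ^ m \<notin> I"
  shows "\<exists>P\<in>subscheme_points I. var j * g \<notin> P"
proof -
  have "ring_ideal I"
    using I by (simp add: homogeneous_ideal_def)
  then obtain P where P: "ring_prime_ideal P" "I \<subseteq> P" and notin: "\<And>m. (var j * g) ^ m \<notin> P"
    using g(2) ring_ideal_avoiding_powers_imp_prime[of I "var j * g"] by blast
  have ideal: "ring_ideal P"
    using P(1) by (simp add: ring_prime_ideal_def)
  \<comment> \<open>The core keeps all homogeneous elements of \<open>P\<close>, among them the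
    homogeneous generators of \<open>I\<close>.\<close>
  have "{f \<in> I. \<exists>d. homogeneous d f} \<subseteq> homogeneous_core P"
    using P(2) homogeneous_in_core_iff[OF ideal] by blast
  then have "ideal_span {f \<in> I. \<exists>d. homogeneous d f} \<subseteq> homogeneous_core P"
    by (rule ideal.span_minimal[OF _ ring_ideal_homogeneous_core[OF ideal]])
  then have "I \<subseteq> homogeneous_core P"
    using I by (simp add: homogeneous_ideal_def)
  moreover have "var j * g \<notin> homogeneous_core P"
    using notin[of 1] homogeneous_in_core_iff[OF ideal homogeneous_mult[OF homogeneous_var g(1)]] by simp
  moreover from this have "var j \<notin> homogeneous_core P"
    using ideal.subspace_scale[OF ring_ideal_homogeneous_core[OF ideal], of "var j" g]
    by (auto simp: mult.commute)
  ultimately show ?thesis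
    using ring_prime_ideal_homogeneous_core[OF P(1)] homogeneous_ideal_core[OF ideal]
    unfolding subscheme_points_def proj_points_def by blast
qed

section \<open>Irreducibility and density\<close>

lemma topspace_zariski: "topspace zariski_topology = proj_points"
proof -
  have "proj_points = {P \<in> proj_points. 1 \<notin> P}"
    by (auto simp: proj_points_def ring_prime_ideal_def)
  then show ?thesis
    unfolding zariski_topology_def topology_generated_by_topspace
    using homogeneous_1 by fast
qed

lemma openin_zariski_nonvanishing:
  "homogeneous d f \<Longrightarrow> openin zariski_topology {P \<in> proj_points. f \<notin> P}"
  unfolding zariski_topology_def by (rule topology_generated_by_Basis) blast

text \<open>Points are prime ideals, so if the product vanished everywhere, the two zero loci,
  closed in the subscheme, would cover it. Irreducibility would make one of them everything.\<close>

lemma irreducible_subscheme_nonvanishing_mult: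
  fixes I :: "('n::finite, 'a::comm_ring_1) mpoly set"
  assumes irr: "irreducible_subscheme I"
    and f: "homogeneous d f" "\<exists>P\<in>subscheme_points I. f \<notin> P"
    and g: "homogeneous e g" "\<exists>P\<in>subscheme_points I. g \<notin> P"
  shows "\<exists>P\<in>subscheme_points I. f * g \<notin> P"
proof (rule ccontr)
  assume none: "\<not> ?thesis"
  let ?Z = "subtopology zariski_topology (subscheme_points I)"
  let ?V = "\<lambda>f. {P \<in> subscheme_points I. f \<in> P}"
  have top: "topspace ?Z = subscheme_points I"
    by (auto simp: topspace_zariski subscheme_points_def)
  have "closedin ?Z (?V f)" if "homogeneous d f" for d and f :: "('n, 'a) mpoly"
  proof -
    have "subscheme_points I - ?V f = {P \<in> proj_points. f \<notin> P} \<inter> subscheme_points I"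
      by (auto simp: subscheme_points_def)
    with openin_zariski_nonvanishing[OF that] show ?thesis
      unfolding closedin_def top openin_subtopology by blast
  qed
  moreover have "?V f \<union> ?V g = subscheme_points I"
    using none by (auto simp: subscheme_points_def proj_points_def ring_prime_ideal_def)
  ultimately have "?V f = subscheme_points I \<or> ?V g = subscheme_points I"
    using irr f(1) g(1) unfolding irreducible_subscheme_def irreducible_space_def top by blast
  with f(2) g(2) show False
    by blast
qed

lemma irreducible_subscheme_nonvanishing_prod:
  fixes f :: "'s \<Rightarrow> ('n::finite, 'a::comm_ring_1) mpoly"
  assumes irr: "irreducible_subscheme I" and "finite S"
    and "\<And>s. s \<in> S \<Longrightarrow> homogeneous (d s) (f s)"
    and "\<And>s. s \<in> S \<Longrightarrow> \<exists>P\<in>subscheme_points I. f s \<notin> P"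
  shows "\<exists>P\<in>subscheme_points I. prod f S \<notin> P"
  using assms(2-)
proof (induction S)
  case empty
  \<comment> \<open>The empty product is 1, which vanishes at no point; irreducibility includes that
    a point exists.\<close>
  have "subscheme_points I \<noteq> {}"
    using irr by (auto simp: irreducible_subscheme_def irreducible_space_def)
  then show ?case
    by (auto simp: subscheme_points_def proj_points_def ring_prime_ideal_def)
next
  case (insert s S)
  have "homogeneous (sum d S) (prod f S)"
    using insert.prems by (intro homogeneous_prod) simp
  then have "\<exists>P\<in>subscheme_points I. f s * prod f S \<notin> P"
    using insert irr
    by (intro irreducible_subscheme_nonvanishing_mult[where d = "d s" and e = "sum d S"]) auto
  then show ?case
    using insert.hyps by simp
qed

text \<open>The value 0 of \<open>h\<close> at \<open>x\<close> lies in every prime ideal of the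
  integers, so \<open>h\<close> belongs to every point in the image of the section \<open>x\<close>.
  The locus where \<open>h\<close> is nonzero is then a neighbourhood of \<open>P\<close> that
  misses all these images.\<close>

lemma not_zariski_dense_if_vanishing:
  assumes h: "homogeneous d h" "\<And>x. x \<in> integral_points I l \<Longrightarrow> eval_poly id x h = 0"
    and P: "P \<in> complement_points I l" "h \<notin> P"
  shows "\<not> integral_points_zariski_dense I l"
proof
  let ?U = "subtopology zariski_topology (complement_points I l)"
  assume "integral_points_zariski_dense I l"
  then have "P \<in> ?U closure_of (\<Union>x\<in>integral_points I l. section_image x)"
    using P(1) by (simp add: integral_points_zariski_dense_def)
  moreover have "openin ?U ({P \<in> proj_points. h \<notin> P} \<inter> complement_points I l)"
    using openin_zariski_nonvanishing[OF h(1)] by (auto simp: openin_subtopology)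
  moreover have "P \<in> {P \<in> proj_points. h \<notin> P} \<inter> complement_points I l"
    using P by (auto simp: complement_points_def subscheme_points_def)
  ultimately obtain y where "y \<in> (\<Union>x\<in>integral_points I l. section_image x)"
      "y \<in> {P \<in> proj_points. h \<notin> P} \<inter> complement_points I l"
    unfolding in_closure_of by meson
  then obtain x where y: "h \<notin> y" "x \<in> integral_points I l" "y \<in> section_image x"
    by blast
  then obtain Q where Q: "ring_prime_ideal Q"
    "y = ideal_span {f. (\<exists>d. homogeneous d f) \<and> eval_poly id x f \<in> Q}"
    by (auto simp: section_image_def)
  then have "0 \<in> Q"
    using ideal.subspace_0 unfolding ring_prime_ideal_def by blast
  then have "h \<in> {f. (\<exists>d. homogeneous d f) \<and> eval_poly id x f \<in> Q}"
    using h(1) h(2)[OF y(2)] by auto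
  then have "h \<in> y"
    unfolding Q(2) by (rule ideal.span_base)
  with y(1) show False
    by blast
qed

section \<open>Values of sections at integral points\<close>

lemma base_change_const: "base_change (const a) = const (of_int a)"
  by (simp add: const_def base_change_single del: single_of_int)

lemma clear_denominators:
  fixes f :: "('n, rat) mpoly"
  obtains N F where "N > (0::int)" "base_change F = const (of_int N) * f"
proof -
  have "\<exists>N>0. \<exists>F. base_change F = const (of_int N :: rat) * f"
  proof (induction f rule: poly_mapping_single_plus_induct)
    case zero
    have "base_change 0 = const (of_int 1 :: rat) * (0 :: ('n, rat) mpoly)"
      by (simp add: base_change.hom_0)
    then show ?case
      using zero_less_one by blast
  next
    case (single m a)
    obtain p q where pq: "quotient_of a = (p, q)"
      by (cases "quotient_of a")
    then have q: "q > 0"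
      by (rule quotient_of_denom_pos)
    then have "of_int p = of_int q * a"
      using quotient_of_div[OF pq] by simp
    then have "base_change (Poly_Mapping.single m p) = const (of_int q) * Poly_Mapping.single m a"
      by (simp add: base_change_single const_def mult_single del: single_of_int)
    with q show ?case
      by blast
  next
    case (plus f g)
    then obtain M F N G where "M > 0" "base_change F = const (of_int M) * f"
      and "N > 0" "base_change G = const (of_int N) * g"
      by blast
    then have "base_change (const N * F + const M * G) = const (of_int (M * N)) * (f + g)"
      by (simp only: base_change.hom_add base_change.hom_mult base_change_const int_const.hom_mult
          ring_distribs mult_ac)
    with \<open>M > 0\<close> \<open>N > 0\<close> show ?case
      by (metis zero_less_mult_iff)
  qed
  with that show ?thesis
    by blast
qed

text \<open>The kernel of evaluation is an ideal, and it contains the generators of the generic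
  fibre.\<close>

lemma vanishing_generic_fibre:
  fixes x :: "int ^ 'n::finite"
  assumes "\<And>f. f \<in> I \<Longrightarrow> eval_poly id x f = 0" "f \<in> generic_fibre I"
  shows "eval_poly of_rat (\<chi> i. real_of_int (x $ i)) f = 0"
proof -
  have "generic_fibre I \<subseteq> {f. eval_poly of_rat (\<chi> i. real_of_int (x $ i)) f = 0}"
    unfolding generic_fibre_def using assms(1)
    by (intro ideal.span_minimal real_eval.subspace_kernel) (auto simp: eval_poly_base_change)
  with assms(2) show ?thesis
    by blast
qed

text \<open>Frees the value from the chart picked by \<open>SOME\<close>. The gluing relation
  evaluated at \<open>x\<close> has a factor \<open>(x $ i * x $ j) ^ N\<close>, nonzero here;
  cancelling it compares the two charts.\<close>

lemma section_value_chart: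
  fixes x :: "real ^ 'n::finite"
  assumes s: "is_global_section J d s" and x: "\<And>f. f \<in> J \<Longrightarrow> eval_poly of_rat x f = 0"
    and i: "x $ i \<noteq> 0"
  shows "section_value s x * (x $ i) ^ snd (s i) = eval_poly of_rat x (fst (s i))"
proof -
  define j where "j = (SOME j. x $ j \<noteq> 0)"
  have j: "x $ j \<noteq> 0"
    unfolding j_def using i by (rule someI)
  obtain N where "(var i * var j) ^ N *
        (fst (s i) * var j ^ snd (s j) - fst (s j) * var i ^ snd (s i)) \<in> J"
    using s unfolding is_global_section_def by blast
  from x[OF this] i j
  have "eval_poly of_rat x (fst (s i)) * (x $ j) ^ snd (s j) =
      eval_poly of_rat x (fst (s j)) * (x $ i) ^ snd (s i)"
    by (simp add: real_eval.hom_mult real_eval.hom_power real_eval.hom_diff rat_to_real.eval_poly_var)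
  with j show ?thesis
    by (simp add: section_value_def Let_def flip: j_def) (simp add: field_simps)
qed

section \<open>Integrality of section values at primitive vectors\<close>

lemma primitive_vector_nonzero:
  fixes x :: "int ^ 'n::finite"
  assumes "Gcd (range (($) x)) = 1"
  obtains i where "x $ i \<noteq> 0"
proof -
  have "\<not> range (($) x) \<subseteq> {0}"
    using assms Gcd_0_iff[of "range (($) x)"] by force
  then show ?thesis
    using that by blast
qed

text \<open>One nonzero coordinate shows that \<open>v\<close> is rational. Its reduced denominator
  divides \<open>(x $ i) ^ e i\<close> for every nonzero coordinate, so a prime dividing it would
  divide all coordinates, zero ones included, against primitivity.\<close>

lemma Ints_if_primitive_multiples:
  fixes x :: "int ^ 'n::finite"
  assumes x: "Gcd (range (($) x)) = 1"
    and v: "\<And>i. x $ i \<noteq> 0 \<Longrightarrow> v * real_of_int (x $ i) ^ e i \<in> \<int>"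
  shows "v \<in> \<int>"
proof -
  obtain i where i: "x $ i \<noteq> 0"
    using x by (rule primitive_vector_nonzero)
  from v[OF this] obtain k where "v * real_of_int (x $ i) ^ e i = of_int k"
    by (auto elim: Ints_cases)
  with i have "v = of_int k / of_int ((x $ i) ^ e i)"
    by (simp add: field_simps)
  then have "v \<in> \<rat>"
    by simp
  then obtain m n :: nat where n: "n \<noteq> 0" "\<bar>v\<bar> = real m / real n" "coprime m n"
    by (rule Rats_abs_nat_div_natE)
  have dvd: "int n dvd (x $ i) ^ e i" if i: "x $ i \<noteq> 0" for i
  proof -
    obtain k where "v * real_of_int (x $ i) ^ e i = of_int k"
      using v[OF i] by (auto elim: Ints_cases)
    then have "\<bar>v\<bar> * \<bar>real_of_int (x $ i) ^ e i\<bar> = \<bar>real_of_int k\<bar>"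
      by (metis abs_mult)
    then have "real m * \<bar>real_of_int (x $ i) ^ e i\<bar> = real n * \<bar>real_of_int k\<bar>"
      using n by (simp add: field_simps)
    then have "real_of_int (int m * \<bar>(x $ i) ^ e i\<bar>) = real_of_int (int n * \<bar>k\<bar>)"
      by simp
    then have "int m * \<bar>(x $ i) ^ e i\<bar> = int n * \<bar>k\<bar>"
      by (simp only: of_int_eq_iff)
    then have "int n dvd int m * \<bar>(x $ i) ^ e i\<bar>"
      by simp
    moreover have "coprime (int n) (int m)"
      using n(3) by (simp add: coprime_commute)
    ultimately show ?thesis
      by (simp add: coprime_dvd_mult_right_iff)
  qed
  have "n = 1"
  proof (rule ccontr)
    assume "n \<noteq> 1"
    then obtain p where p: "prime p" "p dvd n"
      using prime_factor_nat by blast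
    have "int p dvd x $ i" for i
    proof (cases "x $ i = 0")
      case False
      from dvd[OF this] p(2) have "int p dvd (x $ i) ^ e i"
        using dvd_trans int_dvd_int_iff by blast
      with p(1) show ?thesis
        by (metis prime_dvd_power prime_nat_int_transfer)
    qed simp
    then have "int p dvd Gcd (range (($) x))"
      by (auto intro: Gcd_greatest)
    with x p(1) show False
      by auto
  qed
  with n(2) have "v = real m \<or> v = - real m"
    by (simp add: abs_if split: if_splits)
  then show ?thesis
    by auto
qed

text \<open>Clearing denominators chart by chart and multiplying the \<open>N i\<close> makes the
  value integral up to a power of each nonzero coordinate; primitivity removes these powers. The
  resulting bound is independent of \<open>x\<close>.\<close>

lemma section_value_bounded_denominator:
  fixes s :: "'n::finite section_data"
  assumes s: "is_global_section (generic_fibre I) d s"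
  obtains N where "N > (0::int)"
    "\<And>x. x \<in> integral_points I l \<Longrightarrow> of_int N * section_value s (\<chi> i. real_of_int (x $ i)) \<in> \<int>"
proof -
  have "\<exists>N F. N > (0::int) \<and> base_change F = const (of_int N) * fst (s i)" for i
    by (metis clear_denominators)
  then obtain N F where N: "\<And>i. N i > (0::int)"
    and F: "\<And>i. base_change (F i) = const (of_int (N i)) * fst (s i)"
    by metis
  show ?thesis
  proof
    show "prod N UNIV > 0"
      using N by (simp add: prod_pos)
    fix x assume x: "x \<in> integral_points I l"
    let ?x = "\<chi> i. real_of_int (x $ i)"
    show "of_int (prod N UNIV) * section_value s ?x \<in> \<int>"
    proof (rule Ints_if_primitive_multiples)
      show "Gcd (range (($) x)) = 1"
        using x by (simp add: integral_points_def)
      fix i assume i: "x $ i \<noteq> 0"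
      have "section_value s ?x * real_of_int (x $ i) ^ snd (s i) = eval_poly of_rat ?x (fst (s i))"
        using section_value_chart[OF s, of ?x i] vanishing_generic_fibre x i
        by (fastforce simp: integral_points_def)
      moreover have "of_int (N i) * eval_poly of_rat ?x (fst (s i)) = of_int (eval_poly id x (F i))"
        unfolding eval_poly_base_change[symmetric] F
        by (simp add: real_eval.hom_mult rat_to_real.eval_poly_const)
      moreover have "prod N UNIV = N i * prod N (UNIV - {i})"
        by (rule prod.remove) auto
      ultimately have "of_int (prod N UNIV) * section_value s ?x * real_of_int (x $ i) ^ snd (s i)
          = of_int (prod N (UNIV - {i}) * eval_poly id x (F i))"
        by (simp add: mult_ac)
      then show "of_int (prod N UNIV) * section_value s ?x * real_of_int (x $ i) ^ snd (s i) \<in> \<int>"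
        by (metis Ints_of_int)
    qed
  qed
qed

text \<open>Over the rationals \<open>N\<close> becomes invertible, and the power of
  \<open>var j\<close> is absorbed by the localisation. Nilpotency over the integers thus reaches a
  chart of the generic fibre, where reducedness is assumed.\<close>

lemma power_mem_local_ideal_base_change:
  assumes "(var j * F) ^ m \<in> I" "base_change F = const (of_int N) * f" "N \<noteq> 0"
  shows "f ^ m \<in> local_ideal (generic_fibre I) j"
proof -
  let ?u = "const (inverse (of_int N ^ m)) :: ('n::finite, rat) mpoly"
  have ideal: "ring_ideal (generic_fibre I)"
    by (simp add: generic_fibre_def)
  have const_power: "const a ^ m = (const (a ^ m) :: ('n, rat) mpoly)" for a m
    by (induction m) (simp_all add: const_def mult_single)
  have "base_change ((var j * F) ^ m) \<in> generic_fibre I"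
    unfolding generic_fibre_def using assms(1) by (intro ideal.span_base imageI)
  then have mem: "?u * base_change ((var j * F) ^ m) \<in> generic_fibre I"
    by (rule ideal.subspace_scale[OF ideal])
  have eq: "?u * base_change ((var j * F) ^ m) = (?u * const (of_int N ^ m)) * (var j ^ m * f ^ m)"
    by (simp add: base_change.hom_power base_change.hom_mult base_change_var assms(2)
        power_mult_distrib const_power mult_ac)
  have one: "?u * const (of_int N ^ m) = 1"
    using assms(3) by (simp add: const_def mult_single)
  from mem show ?thesis
    unfolding eq one mult_1 local_ideal_def by blast
qed

lemma nonzero_section_vanishing_form:
  fixes I :: "('n::finite, int) mpoly set"
  assumes I: "homogeneous_ideal I" "reduced_subscheme (generic_fibre I)"
    and s: "is_global_section (generic_fibre I) d s"
    and l: "homogeneous 1 l"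
    and neq: "\<not> same_section (generic_fibre I) s (form_section (const a * base_change l ^ d))"
  shows "\<exists>h e. homogeneous e h \<and> (\<exists>P\<in>subscheme_points I. h \<notin> P) \<and>
    (\<forall>x\<in>integral_points I l.
      section_value s (\<chi> i. real_of_int (x $ i)) = of_rat a * of_int (eval_poly id x l) ^ d
        \<longrightarrow> eval_poly id x h = 0)"
proof -
  \<comment> \<open>\<open>?g\<close> is the numerator of the difference of the two sections in a
    chart where they differ.\<close>
  obtain j where j: "fst (s j) - const a * base_change l ^ d * var j ^ snd (s j)
      \<notin> local_ideal (generic_fibre I) j" (is "?g \<notin> _")
    using neq by (auto simp: same_section_def form_section_def)
  obtain N F where N: "N > 0" and F: "base_change F = const (of_int N) * ?g"
    by (rule clear_denominators)
  have "homogeneous (0 + 1 * d + 1 * snd (s j)) (const a * base_change l ^ d * var j ^ snd (s j))"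
    using l
    by (intro homogeneous_mult homogeneous_power homogeneous_const homogeneous_var)
      (simp add: homogeneous_base_change)
  then have g: "homogeneous (d + snd (s j)) ?g"
    using s by (intro homogeneous_diff) (simp_all add: is_global_section_def)
  have "homogeneous (0 + (d + snd (s j))) (base_change F)"
    unfolding F by (intro homogeneous_mult homogeneous_const g)
  then have F_hom: "homogeneous (d + snd (s j)) F"
    by (simp add: homogeneous_base_change)
  \<comment> \<open>If some power lay in \<open>I\<close>, then \<open>?g\<close> would be nilpotent
    in chart \<open>j\<close>; reducedness would make it zero there, against the choice of
    \<open>j\<close>.\<close>
  have "(var j * F) ^ m \<notin> I" for m
    using power_mem_local_ideal_base_change[OF _ F] N I(2) g j
    unfolding reduced_subscheme_def by (metis less_irrefl)
  then have "\<exists>P\<in>subscheme_points I. var j * F \<notin> P"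
    by (rule proj_point_avoiding[OF I(1) F_hom])
  moreover have "eval_poly id x (var j * F) = 0"
    if x: "x \<in> integral_points I l"
      and eq: "section_value s (\<chi> i. real_of_int (x $ i)) = of_rat a * of_int (eval_poly id x l) ^ d"
    for x
  proof (cases "x $ j = 0")
    \<comment> \<open>Outside chart \<open>j\<close> nothing is known about \<open>F\<close>, but
      the extra factor \<open>var j\<close> vanishes.\<close>
    case True
    then show ?thesis
      by (simp add: int_eval.hom_mult int_to_int.eval_poly_var)
  next
    case False
    let ?x = "\<chi> i. real_of_int (x $ i)"
    have "section_value s ?x * real_of_int (x $ j) ^ snd (s j) = eval_poly of_rat ?x (fst (s j))"
      using section_value_chart[OF s, of ?x j] vanishing_generic_fibre x False
      by (fastforce simp: integral_points_def)
    then have "eval_poly of_rat ?x ?g = 0"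
      by (simp add: real_eval.hom_diff real_eval.hom_mult real_eval.hom_power eval_poly_base_change
          rat_to_real.eval_poly_var rat_to_real.eval_poly_const eq)
    then have "real_of_int (eval_poly id x F) = 0"
      unfolding eval_poly_base_change[symmetric] F by (simp add: real_eval.hom_mult)
    then show ?thesis
      by (simp add: int_eval.hom_mult)
  qed
  ultimately show ?thesis
    using homogeneous_mult[OF homogeneous_var F_hom] by blast
qed

text \<open>Evaluation at a real point of the complement kills the generic fibre but not
  \<open>var j * l\<close> for a nonzero coordinate \<open>j\<close>, so no power of that form lies
  in \<open>I\<close>.\<close>

lemma complement_point_if_real_point:
  fixes I :: "('n::finite, int) mpoly set"
  assumes I: "homogeneous_ideal I" and l: "homogeneous 1 l"
    and nonempty: "real_points (generic_fibre I) (base_change l) \<noteq> {}"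
  shows "\<exists>P\<in>subscheme_points I. l \<notin> P"
proof -
  obtain x :: "real ^ 'n" where x: "x \<noteq> 0" "\<forall>f\<in>generic_fibre I. eval_poly of_rat x f = 0"
    "eval_poly of_rat x (base_change l) \<noteq> 0"
    using nonempty by (auto simp: real_points_def)
  obtain j where j: "x $ j \<noteq> 0"
    using x(1) by (auto simp: vec_eq_iff)
  have "(var j * l) ^ m \<notin> I" for m
  proof
    assume "(var j * l) ^ m \<in> I"
    then have "base_change ((var j * l) ^ m) \<in> generic_fibre I"
      unfolding generic_fibre_def by (intro ideal.span_base imageI)
    from bspec[OF x(2) this] j x(3) show False
      by (simp add: base_change.hom_power base_change.hom_mult base_change_var
          real_eval.hom_power real_eval.hom_mult rat_to_real.eval_poly_var)
  qed
  then obtain P where "P \<in> subscheme_points I" "var j * l \<notin> P"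
    using proj_point_avoiding[OF I l] by blast
  moreover from this have "l \<notin> P"
    using ideal.subspace_scale[of P l "var j"]
    unfolding subscheme_points_def proj_points_def ring_prime_ideal_def by blast
  ultimately show ?thesis
    by blast
qed

section \<open>Integral points as real points of the complement\<close>

lemma topspace_real_points_topology: "topspace (real_points_topology I l) = real_points I l"
proof -
  have "topspace (real_proj_topology :: (real ^ 'n::finite) set topology) = real_proj_points"
    using quotient_map_real_proj[where 'n = 'n]
    by (auto simp: quotient_map_def real_proj_points_def)
  then show ?thesis
    by (auto simp: real_points_topology_def real_points_def real_proj_points_def)
qed

lemma span_integral_point:
  fixes x :: "int ^ 'n::finite"
  assumes x: "x \<in> integral_points I l"
  shows "(\<chi> i. real_of_int (x $ i)) \<noteq> 0"
    and "span {\<chi> i. real_of_int (x $ i)} \<in> real_points (generic_fibre I) (base_change l)"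
proof -
  obtain i where "x $ i \<noteq> 0"
    using x by (auto simp: integral_points_def intro: primitive_vector_nonzero)
  then show nz: "(\<chi> i. real_of_int (x $ i)) \<noteq> 0"
    by (auto simp: vec_eq_iff)
  have "eval_poly id x l \<noteq> 0"
    using x by (auto simp: integral_points_def)
  then have "eval_poly of_rat (\<chi> i. real_of_int (x $ i)) (base_change l) \<noteq> 0"
    by (simp add: eval_poly_base_change)
  moreover have "eval_poly of_rat (\<chi> i. real_of_int (x $ i)) f = 0" if "f \<in> generic_fibre I" for f
    using vanishing_generic_fibre[OF _ that] x by (simp add: integral_points_def)
  ultimately show "span {\<chi> i. real_of_int (x $ i)} \<in> real_points (generic_fibre I) (base_change l)"
    unfolding real_points_def using nz by blast
qed

section \<open>From the obstruction to a form vanishing at all integral points\<close>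

theorem theorem2p6:
  fixes I :: "('n::finite, int) mpoly set"
    and l :: "('n, int) mpoly"
  assumes "homogeneous_ideal I"
    and "irreducible_subscheme I"
    and "reduced_subscheme (generic_fibre I)"
    and "homogeneous 1 l"
    and "connected_space (real_points_topology (generic_fibre I) (base_change l))"
    and "weakly_obstructed (generic_fibre I) (base_change l)"
  shows "\<not> integral_points_zariski_dense I l"
proof -
  let ?J = "generic_fibre I" and ?R = "\<lambda>x :: int ^ 'n. \<chi> i. real_of_int (x $ i)"
  obtain U d S c where U: "U \<in> connected_components_of (real_points_topology ?J (base_change l))"
    and "finite S"
    and S': "\<forall>s\<in>S. is_global_section ?J d s \<and> \<not> scalar_multiple_of_form ?J s (base_change l ^ d)"
    and bounded: "\<not> (\<exists>x. x \<noteq> 0 \<and> span {x} \<in> U \<and>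
      (\<forall>s\<in>S. \<bar>section_quotient s (base_change l) d x\<bar> \<ge> c))"
    using assms(6) unfolding weakly_obstructed_def strongly_unobstructed_def by blast
  have S: "is_global_section ?J d s" "\<not> scalar_multiple_of_form ?J s (base_change l ^ d)"
    if "s \<in> S" for s
    using S' that by blast+
  \<comment> \<open>The section that is small may change from point to point, so all of
    \<open>S\<close> has to enter the product below.\<close>
  have less: "\<exists>s\<in>S. \<bar>section_quotient s (base_change l) d x\<bar> < c"
    if "x \<noteq> 0" "span {x} \<in> U" for x
    using bounded that by (meson linorder_not_le)
  \<comment> \<open>A component contains a point, and in a connected space the component of a point
    is the whole space. The bound therefore applies at every real point of the complement.\<close>
  have nonempty: "real_points ?J (base_change l) \<noteq> {}"
    and U_eq: "U = real_points ?J (base_change l)"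
    using U assms(5) connected_space_connected_component_set[of "real_points_topology ?J (base_change l)"]
    by (auto simp: connected_components_of_def topspace_real_points_topology)
  have "\<exists>N>0. \<forall>x\<in>integral_points I l. of_int N * section_value s (?R x) \<in> \<int>" if "s \<in> S" for s
    using section_value_bounded_denominator[OF S(1)[OF that]] by metis
  then obtain N where N: "\<And>s. s \<in> S \<Longrightarrow> N s > (0::int)"
    "\<And>s x. s \<in> S \<Longrightarrow> x \<in> integral_points I l \<Longrightarrow> of_int (N s) * section_value s (?R x) \<in> \<int>"
    by metis
  \<comment> \<open>The pair \<open>(s, k)\<close> stands for the candidate value
    \<open>k / N s\<close> of the quotient of \<open>s\<close> by the \<open>d\<close>-th power of
    \<open>l\<close>; the range of \<open>k\<close> is the bound \<open>c\<close> scaled by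
    \<open>N s\<close>.\<close>
  define T where "T = (SIGMA s:S. {- \<lceil>of_int (N s) * c\<rceil>..\<lceil>of_int (N s) * c\<rceil>})"
  have "finite T"
    using \<open>finite S\<close> by (simp add: T_def)
  define van where "van t h \<longleftrightarrow> (\<forall>x\<in>integral_points I l.
      section_value (fst t) (?R x) = of_rat (of_int (snd t) / of_int (N (fst t))) * of_int (eval_poly id x l) ^ d
        \<longrightarrow> eval_poly id x h = 0)" for t and h :: "('n, int) mpoly"
  have "\<exists>h e. homogeneous e h \<and> (\<exists>P\<in>subscheme_points I. h \<notin> P) \<and> van t h" if "t \<in> T" for t
    unfolding van_def using S[of "fst t"] that
    by (intro nonzero_section_vanishing_form assms) (auto simp: T_def scalar_multiple_of_form_def)
  then obtain h e where h: "\<And>t. t \<in> T \<Longrightarrow> homogeneous (e t) (h t)"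
    "\<And>t. t \<in> T \<Longrightarrow> \<exists>P\<in>subscheme_points I. h t \<notin> P" "\<And>t. t \<in> T \<Longrightarrow> van t (h t)"
    by metis
  have prod_hom: "homogeneous (sum e T) (prod h T)"
    using h(1) by (rule homogeneous_prod)
  have "\<exists>P\<in>subscheme_points I. prod h T \<notin> P"
    using assms(2) \<open>finite T\<close> h(1,2) by (rule irreducible_subscheme_nonvanishing_prod)
  \<comment> \<open>The factor \<open>l\<close> makes the point found lie in the complement of the
    hyperplane.\<close>
  then obtain P where P: "P \<in> subscheme_points I" "l * prod h T \<notin> P"
    using irreducible_subscheme_nonvanishing_mult[OF assms(2) assms(4)
        complement_point_if_real_point[OF assms(1,4) nonempty] prod_hom] by blast
  then have ideal: "ring_ideal P"
    by (auto simp: subscheme_points_def proj_points_def ring_prime_ideal_def)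
  have "prod h T \<notin> P" "l \<notin> P"
    using P(2) ideal.subspace_scale[OF ideal] by (metis, metis mult.commute)
  moreover have "eval_poly id x (prod h T) = 0" if x: "x \<in> integral_points I l" for x
  proof -
    let ?l = "eval_poly id x l"
    have unit: "\<bar>?l\<bar> = 1"
      using x by (simp add: integral_points_def)
    obtain s where s: "s \<in> S" "\<bar>section_quotient s (base_change l) d (?R x)\<bar> < c"
      using less span_integral_point[OF x] U_eq by blast
    then have lt: "\<bar>section_value s (?R x)\<bar> < c"
      using unit by (simp add: section_quotient_def eval_poly_base_change abs_divide power_abs
          flip: of_int_abs)
    obtain k where k: "of_int (N s) * section_value s (?R x) = of_int k"
      using N(2)[OF s(1) x] by (auto elim: Ints_cases)
    have "\<bar>real_of_int k\<bar> = of_int (N s) * \<bar>section_value s (?R x)\<bar>"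
      unfolding k[symmetric] using N(1)[OF s(1)] by (simp add: abs_mult)
    also have "\<dots> \<le> of_int (N s) * c"
      using lt N(1)[OF s(1)] by simp
    finally have "\<bar>k\<bar> \<le> \<lceil>of_int (N s) * c\<rceil>"
      by (simp add: le_ceiling_iff)
    moreover have "\<bar>?l ^ d\<bar> = 1"
      using unit by (simp add: power_abs)
    \<comment> \<open>As \<open>?l ^ d\<close> is a sign, dividing by it is multiplying by it: the
      quotient equals \<open>k * ?l ^ d / N s\<close>, so \<open>k * ?l ^ d\<close> rather than
      \<open>k\<close> is the index.\<close>
    ultimately have t: "(s, k * ?l ^ d) \<in> T" (is "?t \<in> T")
      using s(1) by (auto simp: T_def abs_if split: if_splits)
    have "?l ^ d * ?l ^ d = 1"
      using \<open>\<bar>?l ^ d\<bar> = 1\<close> by (metis abs_mult_self_eq mult_1)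
    then have "real_of_int (k * ?l ^ d) * of_int ?l ^ d = of_int k"
      by (metis mult.assoc mult.right_neutral of_int_mult of_int_power)
    then have "section_value s (?R x)
        = of_rat (of_int (k * ?l ^ d) / of_int (N s)) * of_int ?l ^ d"
      using k N(1)[OF s(1)] by (simp add: of_rat_divide of_rat_mult of_rat_power field_simps)
    then have "eval_poly id x (h ?t) = 0"
      using h(3)[OF t] x by (simp add: van_def)
    with t \<open>finite T\<close> show ?thesis
      by (auto simp: int_eval.hom_prod prod_zero_iff)
  qed
  ultimately show ?thesis
    using P(1) by (intro not_zariski_dense_if_vanishing[OF prod_hom]) (auto simp: complement_points_def)
qed

end
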